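(* Let $A\in\mathbb{R}^{m\times n}$ with $m\ge n$ have full rank and nonzero rows, let $p_1,\dots,p_m>0$ with $\sum_i p_i=1$, and let $x\in\mathbb{R}^n$. For a fixed (deterministic) noise vector $\eta\in\mathbb{R}^m$, let $y=Ax+\eta$, and run the randomized Kaczmarz algorithm on $(A,y)$ with row-selection probabilities $p_i$ from a fixed starting point $x^{(0)}\in\mathbb{R}^n$; let $z^{(k)}=x^{(k)}-x$. Then for a given initial error vector $z^{(0)}$, the mean squared error at the $k$th iteration, for every $k\ge 0$, is $$ \mathbb{E}\,\|z^{(k)}\|^2=\begin{pmatrix}\operatorname{vec}(I_n)\\ 0_n\end{pmatrix}^{T}\left[H^{k}\begin{pmatrix} z^{(0)}\otimes z^{(0)}-v_1\\ z^{(0)}-v_2\end{pmatrix}+\begin{pmatrix}v_1\\ v_2\end{pmatrix}\right], $$ where $H=\begin{pmatrix}Q & D\\ 0 & P\end{pmatrix}$, $v_2=(I-P)^{-1}f$ and $v_1=(I-Q)^{-1}\,[\,e+Dv_2\,]$, with $P,Q,D,e,f$ as defined in the context.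
   Context: Randomized Kaczmarz algorithm: let $a_i\in\mathbb{R}^n$ be the (column vector of the) $i$th row of $A$. Indices $i_1,i_2,\dots$ are drawn independently, with $\Pr(i_k=i)=p_i$, and $$x^{(k)}=x^{(k-1)}+\frac{y_{i_k}-a_{i_k}^Tx^{(k-1)}}{\|a_{i_k}\|^2}\,a_{i_k}.$$ $\mathbb{E}$ denotes expectation over the random row selections only ($\eta$ and $x^{(0)}$ are fixed). Notation: $\tilde a_i=a_i/\|a_i\|$; $\tilde\eta_i=\eta_i/\|a_i\|$; $P_i^{\perp}=I_n-\tilde a_i\tilde a_i^T$; $\otimes$ is the Kronecker product; $\operatorname{vec}$ stacks the columns of a matrix vertically into a vector; $I$ denotes the identity matrix of the appropriate size; $0_n$ is the zero vector in $\mathbb{R}^n$. Define - $P=\sum_i p_i P_i^{\perp}\in\mathbb{R}^{n\times n}$, - $Q=\sum_i p_i\,(P_i^{\perp}\otimes P_i^{\perp})\in\mathbb{R}^{n^2\times n^2}$, - $D=\sum_i p_i\tilde\eta_i\,(\tilde a_i\otimes P_i^{\perp}+P_i^{\perp}\otimes\tilde a_i)\in\mathbb{R}^{n^2\times n}$ (with $\tilde a_i$ regarded as an $n\times 1$ matrix), - $f=\sum_i p_i\tilde\eta_i\tilde a_i\in\mathbb{R}^n$, - $e=\sum_i p_i\tilde\eta_i^{2}\,(\tilde a_i\otimes\tilde a_i)\in\mathbb{R}^{n^2}$. *)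

theory Defs
  imports "HOL-Probability.Probability"
begin

(* Block and Kronecker index sets are types: 'a \<times> 'b, read lexicographically with the first
   component as the outer (slow) index, and 'a + 'b, with the Inl block first. *)

definition kron :: "real^'b^'a \<Rightarrow> real^'d^'c \<Rightarrow> real^('b \<times> 'd)^('a \<times> 'c)" where
  "kron A B = (\<chi> r c. A $ fst r $ fst c * B $ snd r $ snd c)"

definition kron_vec :: "real^'a \<Rightarrow> real^'b \<Rightarrow> real^('a \<times> 'b)" where
  "kron_vec u v = (\<chi> r. u $ fst r * v $ snd r)"

(* Kronecker products of a matrix with a vector regarded as a one-column matrix; the column
   index types 1 \<times> 'n and 'n \<times> 1 are identified with 'n. *)
definition kron_vec_mat :: "real^'a \<Rightarrow> real^'n^'b \<Rightarrow> real^'n^('a \<times> 'b)" where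
  "kron_vec_mat u B = (\<chi> r c. kron (columnvector u :: real^1^'a) B $ r $ (1, c))"

definition kron_mat_vec :: "real^'n^'a \<Rightarrow> real^'b \<Rightarrow> real^'n^('a \<times> 'b)" where
  "kron_mat_vec A v = (\<chi> r c. kron A (columnvector v :: real^1^'b) $ r $ (c, 1))"

(* Column stacking: the column index is the outer one, hence comes first in the pair. *)
definition vec_stack :: "real^'n^'m \<Rightarrow> real^('n \<times> 'm)" where
  "vec_stack M = (\<chi> r. M $ snd r $ fst r)"

definition block_vec :: "real^'a \<Rightarrow> real^'b \<Rightarrow> real^('a + 'b)" where
  "block_vec u v = (\<chi> r. case r of Inl i \<Rightarrow> u $ i | Inr i \<Rightarrow> v $ i)"

definition block_mat ::
    "real^'c^'a \<Rightarrow> real^'d^'a \<Rightarrow> real^'c^'b \<Rightarrow> real^'d^'b \<Rightarrow> real^('c + 'd)^('a + 'b)" where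
  "block_mat M11 M12 M21 M22 = (\<chi> r c.
     case r of
       Inl i \<Rightarrow> (case c of Inl j \<Rightarrow> M11 $ i $ j | Inr j \<Rightarrow> M12 $ i $ j)
     | Inr i \<Rightarrow> (case c of Inl j \<Rightarrow> M21 $ i $ j | Inr j \<Rightarrow> M22 $ i $ j))"

(* The power operation of the type class is componentwise on this type, so it is not used. *)
primrec mat_power :: "real^'n^'n \<Rightarrow> nat \<Rightarrow> real^'n^'n" where
  "mat_power M 0 = mat 1"
| "mat_power M (Suc k) = M ** mat_power M k"

(* The argument s is the sequence of selected rows; its entry s 0 is never used. *)
primrec kaczmarz ::
    "real^'n^'m \<Rightarrow> real^'m \<Rightarrow> real^'n \<Rightarrow> (nat \<Rightarrow> 'm) \<Rightarrow> nat \<Rightarrow> real^'n" where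
  "kaczmarz A y x0 s 0 = x0"
| "kaczmarz A y x0 s (Suc k) =
     kaczmarz A y x0 s k +
     ((y $ s (Suc k) - row (s (Suc k)) A \<bullet> kaczmarz A y x0 s k) / (norm (row (s (Suc k)) A))\<^sup>2)
       *\<^sub>R row (s (Suc k)) A"

definition unit_row :: "real^'n^'m \<Rightarrow> 'm \<Rightarrow> real^'n" where
  "unit_row A i = row i A /\<^sub>R norm (row i A)"

definition scaled_noise :: "real^'n^'m \<Rightarrow> real^'m \<Rightarrow> 'm \<Rightarrow> real" where
  "scaled_noise A \<eta> i = \<eta> $ i / norm (row i A)"

definition row_perp :: "real^'n^'m \<Rightarrow> 'm \<Rightarrow> real^'n^'n" where
  "row_perp A i = mat 1 - (columnvector (unit_row A i) :: real^1^'n) ** rowvector (unit_row A i)"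

definition mat_P :: "real^'n^'m \<Rightarrow> ('m \<Rightarrow> real) \<Rightarrow> real^'n^'n" where
  "mat_P A p = (\<Sum>i\<in>UNIV. p i *\<^sub>R row_perp A i)"

definition mat_Q :: "real^'n^'m \<Rightarrow> ('m \<Rightarrow> real) \<Rightarrow> real^('n \<times> 'n)^('n \<times> 'n)" where
  "mat_Q A p = (\<Sum>i\<in>UNIV. p i *\<^sub>R kron (row_perp A i) (row_perp A i))"

definition mat_D :: "real^'n^'m \<Rightarrow> ('m \<Rightarrow> real) \<Rightarrow> real^'m \<Rightarrow> real^'n^('n \<times> 'n)" where
  "mat_D A p \<eta> = (\<Sum>i\<in>UNIV. (p i * scaled_noise A \<eta> i) *\<^sub>R
     (kron_vec_mat (unit_row A i) (row_perp A i) + kron_mat_vec (row_perp A i) (unit_row A i)))"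

definition vec_f :: "real^'n^'m \<Rightarrow> ('m \<Rightarrow> real) \<Rightarrow> real^'m \<Rightarrow> real^'n" where
  "vec_f A p \<eta> = (\<Sum>i\<in>UNIV. (p i * scaled_noise A \<eta> i) *\<^sub>R unit_row A i)"

definition vec_e :: "real^'n^'m \<Rightarrow> ('m \<Rightarrow> real) \<Rightarrow> real^'m \<Rightarrow> real^('n \<times> 'n)" where
  "vec_e A p \<eta> = (\<Sum>i\<in>UNIV. (p i * (scaled_noise A \<eta> i)\<^sup>2) *\<^sub>R
     kron_vec (unit_row A i) (unit_row A i))"

end

theory Submission
  imports Defs
begin

text \<open>
  One step maps the error $z$ to $P_i^{\perp} z + \tilde\eta_i \tilde a_i$, so both $z$ and
  $z \otimes z$ evolve affinely in the pair $(z \otimes z, z)$.  As the new row index is independent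
  of the current error, averaging gives the affine recursion
  $w \mapsto H w + (e, f)$ for the pair of expectations, whose fixed point is $(v_1, v_2)$.
  The matrices $P$ and $Q$ are averages of orthogonal projections, so any vector fixed by such an
  average is fixed by every projection, hence is orthogonal (columnwise, for $Q$) to every row of
  $A$ and vanishes by full rank.
\<close>

subsection \<open>Kronecker products and block matrices\<close>

lemma sum_matrix_vector_mult:
  fixes M :: "'i \<Rightarrow> real^'n^'m"
  shows "(\<Sum>i\<in>S. M i) *v v = (\<Sum>i\<in>S. M i *v v)"
  by (induction S rule: infinite_finite_induct) (simp_all add: matrix_vector_mult_add_rdistrib)

lemma matrix_inv_vector_mult:
  fixes M :: "real^'n^'n"
  assumes "invertible M"
  shows "M *v (matrix_inv M *v v) = v"
proof -
  have "M ** matrix_inv M = mat 1 \<and> matrix_inv M ** M = mat 1"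
    using assms unfolding invertible_def matrix_inv_def by (rule someI_ex)
  then show ?thesis
    by (simp add: matrix_vector_mul_assoc)
qed

lemma kron_vec_add_left: "kron_vec (u + u') v = kron_vec u v + kron_vec u' v"
  by (simp add: kron_vec_def vec_eq_iff algebra_simps)

lemma kron_vec_add_right: "kron_vec u (v + v') = kron_vec u v + kron_vec u v'"
  by (simp add: kron_vec_def vec_eq_iff algebra_simps)

lemma kron_vec_scaleR_left: "kron_vec (c *\<^sub>R u) v = c *\<^sub>R kron_vec u v"
  by (simp add: kron_vec_def vec_eq_iff)

lemma kron_vec_scaleR_right: "kron_vec u (c *\<^sub>R v) = c *\<^sub>R kron_vec u v"
  by (simp add: kron_vec_def vec_eq_iff)

text \<open>Mixed-product rule: a sum over pairs of indices factors into a product of two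
  sums.\<close>

lemma kron_mult_kron_vec: "kron A B *v kron_vec u v = kron_vec (A *v u) (B *v v)"
  by (simp add: kron_def kron_vec_def vec_eq_iff matrix_vector_mult_def sum_product
      sum.cartesian_product case_prod_unfold mult_ac flip: UNIV_Times_UNIV)

lemma kron_vec_mat_mult: "kron_vec_mat u B *v z = kron_vec u (B *v z)"
  by (simp add: kron_vec_mat_def kron_def columnvector_def kron_vec_def vec_eq_iff
      matrix_vector_mult_def sum_distrib_left mult_ac)

lemma kron_mat_vec_mult: "kron_mat_vec B u *v z = kron_vec (B *v z) u"
  by (simp add: kron_mat_vec_def kron_def columnvector_def kron_vec_def vec_eq_iff
      matrix_vector_mult_def sum_distrib_left mult_ac)

lemma kron_mult_kron: "kron A B ** kron C D = kron (A ** C) (B ** D)"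
  by (simp add: kron_def vec_eq_iff matrix_matrix_mult_def sum_product
      sum.cartesian_product case_prod_unfold mult_ac flip: UNIV_Times_UNIV)

lemma transpose_kron: "transpose (kron A B) = kron (transpose A) (transpose B)"
  by (simp add: kron_def transpose_def vec_eq_iff)

text \<open>Fixing the second index cuts \<open>w\<close> into slices, and the identity factor
  leaves the slices uncoupled. Being fixed by such a product thus becomes a condition on each slice
  separately.\<close>

lemma kron_mat_1_mult_nth:
  "(kron B (mat 1) *v w) $ (j, k) = (B *v (\<chi> i. w $ (i, k))) $ j"
proof -
  have "(kron B (mat 1) *v w) $ (j, k)
      = (\<Sum>i\<in>UNIV. \<Sum>l\<in>UNIV. B $ j $ i * (if k = l then 1 else 0) * w $ (i, l))"
    by (simp add: kron_def matrix_vector_mult_def mat_def sum.cartesian_product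
        case_prod_unfold flip: UNIV_Times_UNIV)
  also have "\<dots> = (\<Sum>i\<in>UNIV. \<Sum>l\<in>UNIV. if k = l then B $ j $ i * w $ (i, l) else 0)"
    by (intro sum.cong refl) simp
  finally show ?thesis
    by (simp add: matrix_vector_mult_def)
qed

lemma block_mat_mult_block_vec:
  "block_mat M11 M12 M21 M22 *v block_vec u v
    = block_vec (M11 *v u + M12 *v v) (M21 *v u + M22 *v v)"
  by (simp add: block_mat_def block_vec_def vec_eq_iff matrix_vector_mult_def
      sum.Plus split: sum.split flip: UNIV_Plus_UNIV)

lemma block_vec_add: "block_vec u v + block_vec u' v' = block_vec (u + u') (v + v')"
  by (simp add: block_vec_def vec_eq_iff split: sum.split)

lemma block_vec_inner: "block_vec u v \<bullet> block_vec u' v' = u \<bullet> u' + v \<bullet> v'"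
  by (simp add: block_vec_def inner_vec_def sum.Plus flip: UNIV_Plus_UNIV)

text \<open>Pairing with vec(I) takes the trace of the matrix unstacked from \<open>w\<close>. The
  trace of z z^T is the squared norm of z, so this pairing extracts the mean squared error from the
  second moments.\<close>

lemma vec_stack_mat_1_inner: "vec_stack (mat 1 :: real^'n^'n) \<bullet> w = (\<Sum>j\<in>UNIV. w $ (j, j))"
proof -
  have "vec_stack (mat 1 :: real^'n^'n) \<bullet> w
      = (\<Sum>j\<in>UNIV. \<Sum>l\<in>UNIV. (if l = j then 1 else 0) * w $ (j, l))"
    by (simp add: vec_stack_def inner_vec_def mat_def sum.cartesian_product
        case_prod_unfold flip: UNIV_Times_UNIV)
  also have "\<dots> = (\<Sum>j\<in>UNIV. \<Sum>l\<in>UNIV. if l = j then w $ (j, l) else 0)"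
    by (intro sum.cong refl) simp
  finally show ?thesis by simp
qed

lemma vec_stack_mat_1_inner_kron_vec: "vec_stack (mat 1) \<bullet> kron_vec z z = (norm z)\<^sup>2"
  unfolding vec_stack_mat_1_inner
  by (simp add: kron_vec_def power2_norm_eq_inner inner_vec_def)

text \<open>Subtracting the fixed point \<open>v\<close> removes the constant term: the difference
  \<open>w k - v\<close> is simply multiplied by \<open>M\<close> at each step.\<close>

lemma mat_power_affine_iterate:
  assumes "\<And>k. w (Suc k) = M *v w k + b" and "v = M *v v + b"
  shows "w k = mat_power M k *v (w 0 - v) + v"
proof (induction k)
  case (Suc k)
  have "w (Suc k) = M *v (mat_power M k *v (w 0 - v)) + (M *v v + b)"
    by (simp only: assms(1) Suc matrix_vector_right_distrib add.assoc)
  then show ?case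
    using assms(2) by (simp add: matrix_vector_mul_assoc)
qed simp

subsection \<open>Averages of orthogonal projections\<close>

text \<open>For an orthogonal projection, |v - M_i v|^2 = <v, v - M_i v>. Averaged with weights that
  sum to 1, the right side becomes <v, v - v> = 0, and positivity of the weights makes every term on
  the left vanish.\<close>

lemma fixed_by_average_of_projections:
  fixes M :: "'i::finite \<Rightarrow> real^'n^'n"
  assumes sym: "\<And>i. transpose (M i) = M i" and idem: "\<And>i. M i ** M i = M i"
    and pos: "\<And>i. p i > 0" and one: "(\<Sum>i\<in>UNIV. p i) = 1"
    and fixed: "(\<Sum>i\<in>UNIV. p i *\<^sub>R M i) *v v = v"
  shows "M i *v v = v"
proof -
  have sq: "(norm (v - M i *v v))\<^sup>2 = v \<bullet> (v - M i *v v)" for i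
  proof -
    \<comment> \<open>Symmetry moves \<open>M i\<close> across the inner product; idempotence then
      makes \<open>M i *v v\<close> orthogonal to \<open>v - M i *v v\<close>.\<close>
    have "(M i *v v) \<bullet> u = v \<bullet> (M i *v u)" for u
      using dot_lmul_matrix[of v "M i" u] sym by (metis transpose_matrix_vector)
    then have "(M i *v v) \<bullet> (v - M i *v v) = 0"
      by (simp add: matrix_vector_mult_diff_distrib matrix_vector_mul_assoc idem)
    then show ?thesis
      by (simp add: power2_norm_eq_inner inner_diff_left)
  qed
  have "(\<Sum>i\<in>UNIV. p i * (norm (v - M i *v v))\<^sup>2) = v \<bullet> (\<Sum>i\<in>UNIV. p i *\<^sub>R (v - M i *v v))"
    by (simp add: sq inner_sum_right)
  also have "(\<Sum>i\<in>UNIV. p i *\<^sub>R (v - M i *v v)) = 0"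
    using fixed by (simp add: scaleR_diff_right sum_subtractf sum_matrix_vector_mult
        scaleR_matrix_vector_assoc one flip: scaleR_sum_left)
  finally have "(\<Sum>i\<in>UNIV. p i * (norm (v - M i *v v))\<^sup>2) = 0"
    by simp
  then have "p i * (norm (v - M i *v v))\<^sup>2 = 0"
    using pos by (subst (asm) sum_nonneg_eq_0_iff) (auto simp: less_imp_le)
  then show ?thesis
    using pos[of i] by simp
qed

section \<open>Row projections, and invertibility of I - P and I - Q\<close>

lemma row_perp_mult:
  fixes A :: "real^'n^'m"
  shows "row_perp A i *v z = z - (unit_row A i \<bullet> z) *\<^sub>R unit_row A i"
proof -
  have "(columnvector (unit_row A i) ** (rowvector (unit_row A i) :: real^'n^1)) *v z
      = (unit_row A i \<bullet> z) *\<^sub>R unit_row A i"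
    by (simp add: vec_eq_iff matrix_vector_mult_def matrix_matrix_mult_def columnvector_def
        rowvector_def inner_vec_def sum_distrib_right sum_distrib_left mult_ac)
  then show ?thesis
    by (simp add: row_perp_def matrix_vector_mult_diff_rdistrib)
qed

lemma transpose_row_perp: "transpose (row_perp A i) = row_perp A i"
  by (simp add: row_perp_def vec_eq_iff transpose_def mat_def matrix_matrix_mult_def
      columnvector_def rowvector_def mult.commute)

lemma norm_unit_row: "row i A \<noteq> 0 \<Longrightarrow> norm (unit_row A i) = 1"
  by (simp add: unit_row_def)

lemma row_perp_idem:
  assumes "row i A \<noteq> 0"
  shows "row_perp A i ** row_perp A i = row_perp A i"
proof -
  have "unit_row A i \<bullet> unit_row A i = 1"
    using norm_unit_row[OF assms] by (simp add: norm_eq_1)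
  then show ?thesis
    by (simp add: matrix_eq row_perp_mult inner_diff_right flip: matrix_vector_mul_assoc)
qed

lemma row_perp_fixed_iff:
  assumes "row i A \<noteq> 0"
  shows "row_perp A i *v z = z \<longleftrightarrow> row i A \<bullet> z = 0"
  using assms norm_unit_row[OF assms] by (auto simp: row_perp_mult unit_row_def)

text \<open>A vector fixed by all the row projections is orthogonal to every row, so
  \<open>A\<close> sends it to 0; full column rank makes \<open>A\<close> injective.\<close>

lemma eq_0_of_row_perp_fixed:
  fixes A :: "real^'n^'m"
  assumes "rank A = CARD('n)" and "\<And>i. row i A \<noteq> 0"
    and "\<And>i. row_perp A i *v z = z"
  shows "z = 0"
proof -
  have "row i A \<bullet> z = 0" for i
    using assms(2,3) row_perp_fixed_iff by blast
  then have "A *v z = A *v 0"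
    by (simp add: vec_eq_iff matrix_vector_mul_component row_def)
  then show ?thesis
    using assms(1) unfolding full_rank_injective by (rule injD[rotated])
qed

text \<open>The kernel of I - M consists of the vectors fixed by M, and a square matrix with trivial
  kernel is invertible.\<close>

lemma invertible_diff_of_no_fixed_vector:
  fixes M :: "real^'n^'n"
  assumes "\<And>v. M *v v = v \<Longrightarrow> v = 0"
  shows "invertible (mat 1 - M)"
  unfolding invertible_left_inverse matrix_left_invertible_ker
  using assms by (simp add: matrix_vector_mult_diff_rdistrib)

lemma invertible_mat_1_diff_mat_P:
  fixes A :: "real^'n^'m"
  assumes "rank A = CARD('n)" and "\<And>i. row i A \<noteq> 0"
    and "\<And>i. p i > 0" and "(\<Sum>i\<in>UNIV. p i) = 1"
  shows "invertible (mat 1 - mat_P A p)"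
proof (rule invertible_diff_of_no_fixed_vector)
  fix v assume "mat_P A p *v v = v"
  then have "row_perp A i *v v = v" for i
    using fixed_by_average_of_projections[of "row_perp A" p v i] assms
    by (simp add: mat_P_def transpose_row_perp row_perp_idem)
  then show "v = 0"
    using eq_0_of_row_perp_fixed assms by blast
qed

text \<open>Kronecker products of orthogonal projections are orthogonal projections, so a vector
  fixed by Q is fixed by each of them. Replacing one tensor factor by the identity then lets full
  rank act slice by slice.\<close>

lemma invertible_mat_1_diff_mat_Q:
  fixes A :: "real^'n^'m"
  assumes "rank A = CARD('n)" and "\<And>i. row i A \<noteq> 0"
    and "\<And>i. p i > 0" and "(\<Sum>i\<in>UNIV. p i) = 1"
  shows "invertible (mat 1 - mat_Q A p)"
proof (rule invertible_diff_of_no_fixed_vector)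
  fix w assume "mat_Q A p *v w = w"
  then have *: "kron (row_perp A i) (row_perp A i) *v w = w" for i
    using fixed_by_average_of_projections[of "\<lambda>i. kron (row_perp A i) (row_perp A i)" p w i] assms
    by (simp add: mat_Q_def transpose_kron kron_mult_kron transpose_row_perp row_perp_idem)
  \<comment> \<open>With R the row projection, R R = R gives (R tensor I)(R tensor R) = R tensor R,
    so whatever R tensor R fixes is also fixed by R tensor I.\<close>
  have left: "kron (row_perp A i) (mat 1) *v w = w" for i
  proof -
    have "kron (row_perp A i) (mat 1) *v (kron (row_perp A i) (row_perp A i) *v w)
        = kron (row_perp A i) (row_perp A i) *v w"
      by (simp add: matrix_vector_mul_assoc kron_mult_kron row_perp_idem assms(2))
    then show ?thesis
      by (simp only: *)
  qed
  have "(\<chi> j. w $ (j, k)) = 0" for k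
  proof (rule eq_0_of_row_perp_fixed[OF assms(1,2)])
    show "row_perp A i *v (\<chi> j. w $ (j, k)) = (\<chi> j. w $ (j, k))" for i
      by (simp add: vec_eq_iff left flip: kron_mat_1_mult_nth)
  qed
  then show "w = 0"
    by (simp add: vec_eq_iff)
qed

subsection \<open>The random iterates\<close>

text \<open>The residual of the selected row i is eta_i - a_i . z, with z the current error: its
  first part yields the noise term, its second the projection.\<close>

lemma kaczmarz_error_Suc:
  assumes "row (s (Suc k)) A \<noteq> 0"
  shows "kaczmarz A (A *v x + \<eta>) x0 s (Suc k) - x
    = row_perp A (s (Suc k)) *v (kaczmarz A (A *v x + \<eta>) x0 s k - x)
      + scaled_noise A \<eta> (s (Suc k)) *\<^sub>R unit_row A (s (Suc k))"
proof -
  define i where "i = s (Suc k)"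
  define u where "u = kaczmarz A (A *v x + \<eta>) x0 s k"
  have "(A *v x) $ i = row i A \<bullet> x"
    by (simp add: matrix_vector_mul_component row_def)
  then show ?thesis
    unfolding kaczmarz.simps i_def[symmetric] u_def[symmetric]
    by (simp add: row_perp_mult unit_row_def scaled_noise_def inner_diff_right
        power2_eq_square divide_simps scaleR_diff_left[symmetric] scaleR_add_left[symmetric]
        algebra_simps)
qed

text \<open>Makes restricting the row sequence to \<open>{1..k}\<close> harmless, so that iterates
  can be treated as functions on a finite product space.\<close>

lemma kaczmarz_cong:
  assumes "\<And>j. j \<in> {1..k} \<Longrightarrow> s j = t j"
  shows "kaczmarz A y x0 s k = kaczmarz A y x0 t k"
  using assms by (induction k) auto

text \<open>Each step chooses among finitely many rows. Finiteness bounds every function of the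
  iterate, which is the source of all integrability below.\<close>

lemma finite_range_kaczmarz: "finite (range (\<lambda>s. kaczmarz A y x0 s k))"
proof (induction k)
  case (Suc k)
  define F where "F = (\<lambda>(i, u). u + ((y $ i - row i A \<bullet> u) / (norm (row i A))\<^sup>2) *\<^sub>R row i A)"
  have "range (\<lambda>s. kaczmarz A y x0 s (Suc k))
      \<subseteq> F ` (UNIV \<times> range (\<lambda>s. kaczmarz A y x0 s k))"
    by (auto simp: F_def image_iff)
  then show ?case
    by (rule finite_subset) (use Suc in simp)
qed simp

text \<open>With the discrete \<open>\<sigma>\<close>-algebra on the target, every function of the iterate is measurable.
  This is possible because the selected rows take only finitely many values.\<close>

lemma measurable_kaczmarz:
  assumes "k \<le> K"
  shows "(\<lambda>s. kaczmarz A y x0 s k)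
    \<in> PiM {1..K} (\<lambda>_. count_space UNIV) \<rightarrow>\<^sub>M count_space UNIV"
  using assms
proof (induction k)
  case (Suc k)
  let ?F = "\<lambda>i u. u + ((y $ i - row i A \<bullet> u) / (norm (row i A))\<^sup>2) *\<^sub>R row i A"
  \<comment> \<open>The next row is first frozen at \<open>i\<close>;
    \<open>measurable_compose_countable\<close> then glues the cases, the row type being
    finite.\<close>
  have "(\<lambda>s. ?F i (kaczmarz A y x0 s k))
      \<in> PiM {1..K} (\<lambda>_. count_space UNIV) \<rightarrow>\<^sub>M count_space UNIV" for i
    by (rule measurable_compose[where N = "count_space UNIV" and g = "?F i"])
      (use Suc in simp_all)
  moreover have "(\<lambda>s. s (Suc k)) \<in> PiM {1..K} (\<lambda>_. count_space UNIV) \<rightarrow>\<^sub>M count_space UNIV"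
    using Suc.prems by (intro measurable_component_singleton) simp
  ultimately have "(\<lambda>s. ?F (s (Suc k)) (kaczmarz A y x0 s k))
      \<in> PiM {1..K} (\<lambda>_. count_space UNIV) \<rightarrow>\<^sub>M count_space UNIV"
    by (rule measurable_compose_countable)
  then show ?case
    by simp
qed simp

section \<open>Measurability, independence and averaging over the next row\<close>

context prob_space
begin

lemma random_variable_kaczmarz:
  assumes "indep_vars (\<lambda>_. count_space UNIV) \<iota> {1..}"
  shows "random_variable (count_space UNIV) (\<lambda>\<omega>. kaczmarz A y x0 (\<lambda>j. \<iota> j \<omega>) k)"
proof -
  \<comment> \<open>Points of \<open>PiM\<close> are extensional functions, hence the restriction;
    \<open>kaczmarz_cong\<close> removes it again.\<close>
  have "(\<lambda>\<omega>. restrict (\<lambda>j. \<iota> j \<omega>) {1..k}) \<in> M \<rightarrow>\<^sub>M PiM {1..k} (\<lambda>_. count_space UNIV)"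
    using assms by (intro measurable_restrict) (auto simp: indep_vars_def)
  from measurable_compose[OF this measurable_kaczmarz[OF order_refl]]
  have "random_variable (count_space UNIV)
      (\<lambda>\<omega>. kaczmarz A y x0 (restrict (\<lambda>j. \<iota> j \<omega>) {1..k}) k)" .
  moreover have "kaczmarz A y x0 (restrict (\<lambda>j. \<iota> j \<omega>) {1..k}) k
      = kaczmarz A y x0 (\<lambda>j. \<iota> j \<omega>) k" for \<omega>
    by (rule kaczmarz_cong) simp
  ultimately show ?thesis
    by simp
qed

text \<open>The two variables depend on the disjoint index blocks \<open>{1..k}\<close> and
  \<open>{Suc k}\<close>. Since \<open>indep_var\<close> relates variables with values in one type,
  \<open>g\<close> and \<open>h\<close> map iterate and row index to a common space.\<close>

lemma indep_var_kaczmarz: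
  fixes g :: "real^'n \<Rightarrow> 'b::topological_space" and h :: "'m::finite \<Rightarrow> 'b"
  assumes "indep_vars (\<lambda>_. count_space UNIV) \<iota> {1..}"
  shows "indep_var borel (\<lambda>\<omega>. g (kaczmarz A y x0 (\<lambda>j. \<iota> j \<omega>) k)) borel (\<lambda>\<omega>. h (\<iota> (Suc k) \<omega>))"
proof -
  have "(\<lambda>s. g (kaczmarz A y x0 s k)) \<in> borel_measurable (PiM {1..k} (\<lambda>_. count_space UNIV))"
    by (rule measurable_compose[OF measurable_kaczmarz]) simp_all
  moreover have "(\<lambda>s. h (s (Suc k))) \<in> borel_measurable (PiM {Suc k} (\<lambda>_. count_space UNIV))"
    by (rule measurable_compose[OF measurable_component_singleton]) simp_all
  ultimately have "indep_var borel
      ((\<lambda>s. g (kaczmarz A y x0 s k)) \<circ> (\<lambda>\<omega>. restrict (\<lambda>j. \<iota> j \<omega>) {1..k}))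
      borel ((\<lambda>s. h (s (Suc k))) \<circ> (\<lambda>\<omega>. restrict (\<lambda>j. \<iota> j \<omega>) {Suc k}))"
    by (intro indep_var_compose[OF indep_var_restrict[OF assms]]) auto
  moreover have "kaczmarz A y x0 (restrict (\<lambda>j. \<iota> j \<omega>) {1..k}) k
      = kaczmarz A y x0 (\<lambda>j. \<iota> j \<omega>) k" for \<omega>
    by (rule kaczmarz_cong) simp
  ultimately show ?thesis
    by (simp add: comp_def)
qed

text \<open>The sum of the norms over the finite range is a bound, and the discrete \<sigma>-algebra
  makes any \<open>g\<close> measurable.\<close>

lemma integrable_of_finite_range:
  fixes g :: "'c \<Rightarrow> 'b::{banach, second_countable_topology}"
  assumes "random_variable (count_space UNIV) Z" and "finite (range Z)"
  shows "integrable M (\<lambda>\<omega>. g (Z \<omega>))"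
proof (rule integrable_const_bound)
  show "AE \<omega> in M. norm (g (Z \<omega>)) \<le> (\<Sum>c\<in>range Z. norm (g c))"
    using assms(2) by (intro AE_I2 member_le_sum) auto
  show "(\<lambda>\<omega>. g (Z \<omega>)) \<in> borel_measurable M"
    using assms(1) by (rule measurable_compose) simp
qed

text \<open>Total expectation: split by the value of \<open>J\<close> and factor each piece by
  independence. Real-valued test functions suffice in \<open>ind\<close> because the argument runs
  coordinate by coordinate.\<close>

lemma expectation_indep_finite_choice:
  fixes G :: "'i::finite \<Rightarrow> 'c \<Rightarrow> real^'d"
  assumes ind: "\<And>(g :: 'c \<Rightarrow> real) h. indep_var borel (\<lambda>\<omega>. g (Z \<omega>)) borel (\<lambda>\<omega>. h (J \<omega>))"
    and Z: "random_variable (count_space UNIV) Z" and fin: "finite (range Z)"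
    and J: "random_variable (count_space UNIV) J"
  shows "expectation (\<lambda>\<omega>. G (J \<omega>) (Z \<omega>))
    = (\<Sum>i\<in>UNIV. prob {\<omega> \<in> space M. J \<omega> = i} *\<^sub>R expectation (\<lambda>\<omega>. G i (Z \<omega>)))"
proof -
  note int = integrable_of_finite_range[OF Z fin] integrable_of_finite_range[OF J finite]
  \<comment> \<open>The probability of \<open>J \<omega> = i\<close> arises as the expectation of an
    indicator. Integrability of the products is kept for exchanging sum and expectation.\<close>
  have prod: "expectation (\<lambda>\<omega>. indicat_real {i} (J \<omega>) * h (Z \<omega>))
      = prob {\<omega> \<in> space M. J \<omega> = i} * expectation (\<lambda>\<omega>. h (Z \<omega>))"
    and int_prod: "integrable M (\<lambda>\<omega>. indicat_real {i} (J \<omega>) * h (Z \<omega>))" for i and h :: "'c \<Rightarrow> real"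
  proof -
    have "expectation (\<lambda>\<omega>. indicat_real {i} (J \<omega>))
        = expectation (indicat_real {\<omega> \<in> space M. J \<omega> = i})"
      by (intro Bochner_Integration.integral_cong) (auto simp: indicator_def)
    also have "\<dots> = prob ({\<omega> \<in> space M. J \<omega> = i} \<inter> space M)"
      by (rule Bochner_Integration.integral_indicator)
    also have "{\<omega> \<in> space M. J \<omega> = i} \<inter> space M = {\<omega> \<in> space M. J \<omega> = i}"
      by auto
    finally show "expectation (\<lambda>\<omega>. indicat_real {i} (J \<omega>) * h (Z \<omega>))
        = prob {\<omega> \<in> space M. J \<omega> = i} * expectation (\<lambda>\<omega>. h (Z \<omega>))"
      using indep_var_lebesgue_integral[OF ind[of h "indicat_real {i}"] int] by (simp add: mult.commute)
    show "integrable M (\<lambda>\<omega>. indicat_real {i} (J \<omega>) * h (Z \<omega>))"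
      using indep_var_integrable[OF ind[of h "indicat_real {i}"] int] by (simp add: mult.commute)
  qed
  have nth: "expectation F $ c = expectation (\<lambda>\<omega>. F \<omega> $ c)" if "integrable M F"
    for F :: "'a \<Rightarrow> real^'d" and c
    using integral_bounded_linear[OF bounded_linear_vec_nth that] by simp
  \<comment> \<open>Taking coordinates through the integral requires integrability of the joint
    function; the pair of \<open>J\<close> and \<open>Z\<close> again has finite range.\<close>
  have "integrable M (\<lambda>\<omega>. (\<lambda>(j, c). G j c) (J \<omega>, Z \<omega>))"
  proof (rule integrable_of_finite_range[where Z = "\<lambda>\<omega>. (J \<omega>, Z \<omega>)"])
    show "random_variable (count_space UNIV) (\<lambda>\<omega>. (J \<omega>, Z \<omega>))"
      by (rule measurable_compose_countable[OF _ J, where f = "\<lambda>j \<omega>. (j, Z \<omega>)"])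
        (rule measurable_compose[OF Z], simp)
    show "finite (range (\<lambda>\<omega>. (J \<omega>, Z \<omega>)))"
      by (rule finite_subset[of _ "UNIV \<times> range Z"]) (use fin in auto)
  qed
  then have intG: "integrable M (\<lambda>\<omega>. G (J \<omega>) (Z \<omega>))"
    by simp
  show ?thesis
  proof (rule vec_eq_iff[THEN iffD2, rule_format])
    fix c
    \<comment> \<open>Exactly one indicator equals 1, so the sum selects the term with
      \<open>i = J \<omega>\<close>.\<close>
    have "expectation (\<lambda>\<omega>. G (J \<omega>) (Z \<omega>)) $ c
        = expectation (\<lambda>\<omega>. \<Sum>i\<in>UNIV. indicat_real {i} (J \<omega>) * G i (Z \<omega>) $ c)"
      by (simp add: nth[OF intG] indicator_def if_distrib[of "\<lambda>t. t * _"] cong: if_cong)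
    also have "\<dots> = (\<Sum>i\<in>UNIV. prob {\<omega> \<in> space M. J \<omega> = i} * expectation (\<lambda>\<omega>. G i (Z \<omega>) $ c))"
      by (subst Bochner_Integration.integral_sum)
        (simp_all add: prod[of i "\<lambda>z. G i z $ c" for i] int_prod[of i "\<lambda>z. G i z $ c" for i])
    finally show "expectation (\<lambda>\<omega>. G (J \<omega>) (Z \<omega>)) $ c
        = (\<Sum>i\<in>UNIV. prob {\<omega> \<in> space M. J \<omega> = i} *\<^sub>R expectation (\<lambda>\<omega>. G i (Z \<omega>))) $ c"
      by (simp add: nth[OF int(1)])
  qed
qed

end

section \<open>The affine recursion for the first two moments\<close>

theorem proposition1:
  fixes A :: "real^'n^'m"
    and p :: "'m \<Rightarrow> real"
    and x x0 :: "real^'n"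
    and \<eta> y :: "real^'m"
    and \<Omega> :: "'w measure"
    and \<iota> :: "nat \<Rightarrow> 'w \<Rightarrow> 'm"
    and z :: "nat \<Rightarrow> 'w \<Rightarrow> real^'n"
    and z0 v2 :: "real^'n"
    and v1 :: "real^('n \<times> 'n)"
    and H :: "real^(('n \<times> 'n) + 'n)^(('n \<times> 'n) + 'n)"
  assumes "CARD('m) \<ge> CARD('n)"
    and "rank A = min CARD('m) CARD('n)"
    and "\<And>i. row i A \<noteq> 0"
    and "\<And>i. p i > 0"
    and "(\<Sum>i\<in>UNIV. p i) = 1"
    and "y = A *v x + \<eta>"
    and "prob_space \<Omega>"
    and "prob_space.indep_vars \<Omega> (\<lambda>_. count_space UNIV) \<iota> {1..}"
    and "\<And>k i. k \<ge> 1 \<Longrightarrow> measure \<Omega> {\<omega> \<in> space \<Omega>. \<iota> k \<omega> = i} = p i"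
    and "\<And>k \<omega>. z k \<omega> = kaczmarz A y x0 (\<lambda>j. \<iota> j \<omega>) k - x"
    and "z0 = x0 - x"
    and "H = block_mat (mat_Q A p) (mat_D A p \<eta>) 0 (mat_P A p)"
    and "v2 = matrix_inv (mat 1 - mat_P A p) *v vec_f A p \<eta>"
    and "v1 = matrix_inv (mat 1 - mat_Q A p) *v (vec_e A p \<eta> + mat_D A p \<eta> *v v2)"
  shows "invertible (mat 1 - mat_P A p) \<and>
    invertible (mat 1 - mat_Q A p) \<and>
    (\<forall>k. (\<integral>\<omega>. (norm (z k \<omega>))\<^sup>2 \<partial>\<Omega>) =
      block_vec (vec_stack (mat 1 :: real^'n^'n)) (0 :: real^'n) \<bullet>
        (mat_power H k *v block_vec (kron_vec z0 z0 - v1) (z0 - v2) + block_vec v1 v2))"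
proof -
  interpret prob_space \<Omega> by fact
  have rank: "rank A = CARD('n)"
    using assms(1,2) by simp
  \<comment> \<open>Only for invertible matrices is \<open>matrix_inv\<close> a genuine inverse, so
    this comes before any use of \<open>v1\<close> and \<open>v2\<close>.\<close>
  have invP: "invertible (mat 1 - mat_P A p)" and invQ: "invertible (mat 1 - mat_Q A p)"
    using invertible_mat_1_diff_mat_P invertible_mat_1_diff_mat_Q rank assms(3-5) by blast+
  have "(mat 1 - mat_P A p) *v v2 = vec_f A p \<eta>"
    unfolding assms(13) by (rule matrix_inv_vector_mult[OF invP])
  moreover have "(mat 1 - mat_Q A p) *v v1 = vec_e A p \<eta> + mat_D A p \<eta> *v v2"
    unfolding assms(14) by (rule matrix_inv_vector_mult[OF invQ])
  \<comment> \<open>Together these say that the pair of \<open>v1\<close> and \<open>v2\<close> is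
    fixed by the affine map w -> H w + (e, f).\<close>
  ultimately have v2: "v2 = mat_P A p *v v2 + vec_f A p \<eta>"
    and v1: "v1 = mat_Q A p *v v1 + mat_D A p \<eta> *v v2 + vec_e A p \<eta>"
    by (simp_all add: matrix_vector_mult_diff_rdistrib algebra_simps)
  let ?R = "row_perp A" and ?u = "unit_row A" and ?s = "scaled_noise A \<eta>"
  define step where "step = (\<lambda>i u. ?R i *v u + ?s i *\<^sub>R ?u i)"
  have z_Suc: "z (Suc k) \<omega> = step (\<iota> (Suc k) \<omega>) (z k \<omega>)" for k \<omega>
    using kaczmarz_error_Suc[of "\<lambda>j. \<iota> j \<omega>" k A x \<eta> x0] assms(3)
    by (simp only: assms(6,10) step_def not_False_eq_True)
  have ind: "indep_var borel (\<lambda>\<omega>. g (z k \<omega>)) borel (\<lambda>\<omega>. h (\<iota> (Suc k) \<omega>))"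
    for k and g :: "real^'n \<Rightarrow> real" and h
    unfolding assms(10) by (rule indep_var_kaczmarz[OF assms(8), where g = "\<lambda>u. g (u - x)"])
  have rv_z: "random_variable (count_space UNIV) (z k)" for k
    unfolding assms(10)[abs_def]
    by (rule measurable_compose[OF random_variable_kaczmarz[OF assms(8)]]) simp
  have rv_row: "random_variable (count_space UNIV) (\<iota> (Suc k))" for k
    using assms(8) by (simp add: indep_vars_def)
  have fin: "finite (range (z k))" for k
    by (rule finite_subset[of _ "(\<lambda>u. u - x) ` range (\<lambda>s. kaczmarz A y x0 s k)"])
      (auto simp: assms(10) finite_range_kaczmarz)
  note int = integrable_of_finite_range[OF rv_z fin]
  \<comment> \<open>The fresh row is integrated out first, leaving for each fixed row an expectation
    over the current error alone.\<close>
  have average: "expectation (\<lambda>\<omega>. G (\<iota> (Suc k) \<omega>) (z k \<omega>))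
      = (\<Sum>i\<in>UNIV. p i *\<^sub>R expectation (\<lambda>\<omega>. G i (z k \<omega>)))"
    for k and G :: "'m \<Rightarrow> real^'n \<Rightarrow> real^'d"
    using expectation_indep_finite_choice[OF ind rv_z fin rv_row, of G k] by (simp add: assms(9))
  have mult: "expectation (\<lambda>\<omega>. B *v F (z k \<omega>)) = B *v expectation (\<lambda>\<omega>. F (z k \<omega>))"
    for k and B :: "real^'d^'c" and F
    by (rule integral_bounded_linear[OF matrix_vector_mul_bounded_linear int])
  define m where "m = (\<lambda>k. expectation (z k))"
  define S where "S = (\<lambda>k. expectation (\<lambda>\<omega>. kron_vec (z k \<omega>) (z k \<omega>)))"
  have m_Suc: "m (Suc k) = mat_P A p *v m k + vec_f A p \<eta>" for k
  proof -
    have "expectation (\<lambda>\<omega>. step i (z k \<omega>)) = ?R i *v m k + ?s i *\<^sub>R ?u i" for i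
      using mult[of "?R i" "\<lambda>u. u" k] by (simp add: step_def m_def prob_space int)
    then have "m (Suc k) = (\<Sum>i\<in>UNIV. p i *\<^sub>R (?R i *v m k + ?s i *\<^sub>R ?u i))"
      by (simp add: m_def z_Suc[abs_def] average)
    then show ?thesis
      by (simp add: mat_P_def vec_f_def sum_matrix_vector_mult scaleR_add_right sum.distrib
          scaleR_matrix_vector_assoc)
  qed
  have S_Suc: "S (Suc k) = mat_Q A p *v S k + mat_D A p \<eta> *v m k + vec_e A p \<eta>" for k
  proof -
    let ?K = "\<lambda>i. kron (?R i) (?R i)"
    define D where "D = (\<lambda>i. kron_vec_mat (?u i) (?R i) + kron_mat_vec (?R i) (?u i))"
    have mat_D: "mat_D A p \<eta> = (\<Sum>i\<in>UNIV. (p i * ?s i) *\<^sub>R D i)"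
      by (simp add: mat_D_def D_def)
    \<comment> \<open>Expanding the square of projection plus noise: the pure projection term gives
      Q, the two cross terms give D, and the pure noise term gives e.\<close>
    have "kron_vec (step i u) (step i u)
        = ?K i *v kron_vec u u + (?s i *\<^sub>R D i) *v u + (?s i)\<^sup>2 *\<^sub>R kron_vec (?u i) (?u i)" for i u
      by (simp add: step_def D_def kron_mult_kron_vec matrix_vector_mult_add_rdistrib kron_vec_mat_mult
          kron_mat_vec_mult kron_vec_add_left kron_vec_add_right kron_vec_scaleR_left
          kron_vec_scaleR_right power2_eq_square scaleR_add_right flip: scaleR_matrix_vector_assoc)
    then have "expectation (\<lambda>\<omega>. kron_vec (step i (z k \<omega>)) (step i (z k \<omega>)))
        = ?K i *v S k + (?s i *\<^sub>R D i) *v m k + (?s i)\<^sup>2 *\<^sub>R kron_vec (?u i) (?u i)" for i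
      using mult[of "?K i" "\<lambda>u. kron_vec u u" k] mult[of "?s i *\<^sub>R D i" "\<lambda>u. u" k]
      by (simp add: S_def m_def prob_space int[where g = "\<lambda>u. _ *v kron_vec u u"]
          int[where g = "\<lambda>u. _ *v u"]
          int[where g = "\<lambda>u. _ *v kron_vec u u + _ *v u"])
    then have "S (Suc k) = (\<Sum>i\<in>UNIV. p i *\<^sub>R (?K i *v S k + (?s i *\<^sub>R D i) *v m k
        + (?s i)\<^sup>2 *\<^sub>R kron_vec (?u i) (?u i)))"
      using average[of "\<lambda>i u. kron_vec (step i u) (step i u)" k] by (simp add: S_def z_Suc)
    then show ?thesis
      by (simp add: mat_Q_def mat_D vec_e_def sum_matrix_vector_mult scaleR_add_right
          sum.distrib scaleR_matrix_vector_assoc)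
  qed
  \<comment> \<open>The initial error is deterministic, so its moments are its values, the total
    mass being 1.\<close>
  have z0: "m 0 = z0" "S 0 = kron_vec z0 z0"
    by (simp_all add: m_def S_def assms(10)[abs_def] assms(11) prob_space)
  have iterate: "block_vec (S k) (m k)
      = mat_power H k *v (block_vec (S 0) (m 0) - block_vec v1 v2) + block_vec v1 v2" for k
  proof (rule mat_power_affine_iterate[where b = "block_vec (vec_e A p \<eta>) (vec_f A p \<eta>)"])
    show "block_vec (S (Suc k)) (m (Suc k))
        = H *v block_vec (S k) (m k) + block_vec (vec_e A p \<eta>) (vec_f A p \<eta>)" for k
      by (simp add: assms(12) block_mat_mult_block_vec block_vec_add S_Suc m_Suc)
    show "block_vec v1 v2 = H *v block_vec v1 v2 + block_vec (vec_e A p \<eta>) (vec_f A p \<eta>)"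
      by (simp add: assms(12) block_mat_mult_block_vec block_vec_add flip: v1 v2)
  qed
  have diff: "block_vec (S 0) (m 0) - block_vec v1 v2 = block_vec (kron_vec z0 z0 - v1) (z0 - v2)"
    by (simp add: z0 diff_eq_eq block_vec_add)
  have "expectation (\<lambda>\<omega>. (norm (z k \<omega>))\<^sup>2)
      = block_vec (vec_stack (mat 1 :: real^'n^'n)) (0 :: real^'n) \<bullet> block_vec (S k) (m k)" for k
  proof -
    \<comment> \<open>Pairing with vec(I) is linear and passes through the expectation; the zero
      block then discards the mean \<open>m k\<close>.\<close>
    have "expectation (\<lambda>\<omega>. vec_stack (mat 1 :: real^'n^'n) \<bullet> kron_vec (z k \<omega>) (z k \<omega>))
        = vec_stack (mat 1) \<bullet> S k"
      unfolding S_def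
      by (rule integral_bounded_linear[OF bounded_linear_inner_right int[where g = "\<lambda>u. kron_vec u u"]])
    then show ?thesis
      by (simp add: block_vec_inner vec_stack_mat_1_inner_kron_vec)
  qed
  then show ?thesis
    using invP invQ by (simp add: iterate[unfolded diff])
qed

end
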